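(* Fix a network $N=(V,A,s,t)$, a nonempty set $W\subseteq V\setminus\{s,t\}$ of storage nodes, integer capacities $u=(u_x)_{x\in A\cup W}$, a set $A_1\subseteq A$ of arcs with maintenance jobs, and an integer time horizon $T$. Then for every choice of integer job parameters $(p_a,r_a,d_a)_{a\in A_1}$ there exists an optimal solution $t^*=(t^*_a)_{a\in A_1}$ of $\varphi^*=\max\{\operatorname{val}(t^* ) : t^*\in X\}$ in which all start times $t^*_a$ are rational. Further, the denominators of these rational optimal start times do not depend on the job parameters: there is a positive integer $D$, not depending on $(p_a,r_a,d_a)_{a\in A_1}$, such that for every choice of integer job parameters there exists an optimal solution $t^*$ with $D\,t^*_a\in\mathbb{Z}$ for all $a\in A_1$.
   Context: The maintenance scheduling problem. $N=(V,A,s,t)$ is a finite directed network (parallel arcs allowed) with distinct source $s$ and sink $t$; $\delta^{\text{out}}(v)$ and $\delta^{\text{in}}(v)$ are the sets of arcs starting, respectively ending, at $v$. $W\subseteq V\setminus\{s,t\}$ is a set of storage nodes, and $u=(u_x)_{x\in A\cup W}$ are nonnegative capacities (flow per unit time for arcs, stored amount for nodes in $W$). $T>0$ is the time horizon. $A_1\subseteq A$ is the set of arcs with a maintenance job; each $a\in A_1$ has exactly one job, with processing time $p_a>0$, release time $r_a$ and deadline $d_a$, where $0\leqslant r_a\leqslant d_a-p_a$ and $d_a\leqslant T$. A feasible solution is a start time vector $t^*=(t^*_a)_{a\in A_1}\in X:=\prod_{a\in A_1}[r_a,d_a-p_a]$. Value of a solution. Given $t^*\in X$, let $0=t_0<t_1<\cdots<t_n=T$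 be the increasing enumeration of the set $\{t^*_a : a\in A_1\}\cup\{t^*_a+p_a : a\in A_1\}\cup\{0,T\}$, and for $a\in A_1$ let $I_a=\{i\in\{1,\dots,n\} : t^*_a<t_i\leqslant t^*_a+p_a\}$. Then $\operatorname{val}(t^* )$ is the maximum of $\sum_{i=1}^n\big(\sum_{a\in\delta^{\text{out}}(s)}x_{ai}-\sum_{a\in\delta^{\text{in}}(s)}x_{ai}\big)$ over all nonnegative reals $x_{ai}$ ($a\in A$, $1\leqslant i\leqslant n$) and $x_{vi}$ ($v\in W$, $0\leqslant i\leqslant n$) satisfying: $\sum_{a\in\delta^{\text{out}}(v)}x_{ai}=\sum_{a\in\delta^{\text{in}}(v)}x_{ai}$ for $v\in V\setminus(W\cup\{s,t\})$, $1\leqslant i\leqslant n$; $\sum_{a\in\delta^{\text{out}}(v)}x_{ai}+x_{vi}=\sum_{a\in\delta^{\text{in}}(v)}x_{ai}+x_{v,i-1}$ for $v\in W$, $1\leqslant i\leqslant n$; $x_{ai}\leqslant(t_i-t_{i-1})u_a$ for $a\in A\setminus A_1$ and all $i$, and for $a\in A_1$ and $i\notin I_a$; $x_{ai}=0$ for $a\in A_1$, $i\in I_a$; $x_{vi}\leqslant u_v$ for $v\in W$, $0\leqslant i\leqslant n$; $x_{v0}=x_{vn}=0$ for $v\in W$. The problem is to determine $\varphi^*=\max\{\operatorname{val}(t^* ) : t^*\in X\}$; an optimal solution is a $t^*\in X$ attaining this maximum. *)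

theory Defs
  imports Complex_Main "HOL-Library.FuncSet" "Graph_Theory.Digraph"
begin

text \<open>
  A flow network with storage nodes \<open>W\<close>, arc capacities \<open>cap\<close> (per unit time), storage capacities
  \<open>scap\<close>, one maintenance job on each arc of \<open>A1\<close>, and time horizon \<open>T\<close>. Arcs are abstract
  objects, so parallel arcs are allowed; loops are allowed too, and cancel in every balance equation.
\<close>

locale maintenance_network = fin_digraph N
  for N :: "('v, 'e) pre_digraph" +
  fixes src snk :: 'v
    and W :: "'v set"
    and cap :: "'e \<Rightarrow> real"
    and scap :: "'v \<Rightarrow> real"
    and A1 :: "'e set"
    and T :: real
  assumes src_in_verts: "src \<in> verts N"
    and snk_in_verts: "snk \<in> verts N"
    and src_neq_snk: "src \<noteq> snk"
    and storage_subset: "W \<subseteq> verts N - {src, snk}"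
    and cap_nonneg: "\<And>a. a \<in> arcs N \<Longrightarrow> 0 \<le> cap a"
    and scap_nonneg: "\<And>v. v \<in> W \<Longrightarrow> 0 \<le> scap v"
    and jobs_subset: "A1 \<subseteq> arcs N"
    and horizon_pos: "0 < T"
begin

text \<open>Job parameters: processing times \<open>p\<close>, release times \<open>r\<close>, deadlines \<open>d\<close>.\<close>

definition valid_jobs :: "('e \<Rightarrow> real) \<Rightarrow> ('e \<Rightarrow> real) \<Rightarrow> ('e \<Rightarrow> real) \<Rightarrow> bool" where
  "valid_jobs p r d \<longleftrightarrow> (\<forall>a\<in>A1. 0 < p a \<and> 0 \<le> r a \<and> r a \<le> d a - p a \<and> d a \<le> T)"

definition feasible_starts :: "('e \<Rightarrow> real) \<Rightarrow> ('e \<Rightarrow> real) \<Rightarrow> ('e \<Rightarrow> real) \<Rightarrow> ('e \<Rightarrow> real) set" where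
  "feasible_starts p r d = (\<Pi>\<^sub>E a\<in>A1. {r a..d a - p a})"

definition event_times :: "('e \<Rightarrow> real) \<Rightarrow> ('e \<Rightarrow> real) \<Rightarrow> real set" where
  "event_times p ts = ts ` A1 \<union> (\<lambda>a. ts a + p a) ` A1 \<union> {0, T}"

text \<open>
  The increasing enumeration of the event times is \<open>event_time p ts 0 < \<dots> < event_time p ts n\<close>
  with \<open>n = num_intervals p ts\<close>.
\<close>

definition num_intervals :: "('e \<Rightarrow> real) \<Rightarrow> ('e \<Rightarrow> real) \<Rightarrow> nat" where
  "num_intervals p ts = card (event_times p ts) - 1"

definition event_time :: "('e \<Rightarrow> real) \<Rightarrow> ('e \<Rightarrow> real) \<Rightarrow> nat \<Rightarrow> real" where
  "event_time p ts i = sorted_list_of_set (event_times p ts) ! i"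

definition outage :: "('e \<Rightarrow> real) \<Rightarrow> ('e \<Rightarrow> real) \<Rightarrow> 'e \<Rightarrow> nat set" where
  "outage p ts a = {i \<in> {1..num_intervals p ts}.
     ts a < event_time p ts i \<and> event_time p ts i \<le> ts a + p a}"

text \<open>
  \<open>x a i\<close> is the flow on arc \<open>a\<close> in interval \<open>i\<close>, and \<open>y v i\<close> is the amount stored at \<open>v\<close> at the
  end of interval \<open>i\<close>.
\<close>

definition feasible_flow ::
    "('e \<Rightarrow> real) \<Rightarrow> ('e \<Rightarrow> real) \<Rightarrow> ('e \<Rightarrow> nat \<Rightarrow> real) \<Rightarrow> ('v \<Rightarrow> nat \<Rightarrow> real) \<Rightarrow> bool" where
  "feasible_flow p ts x y \<longleftrightarrow>
     (let n = num_intervals p ts; \<tau> = event_time p ts in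
       (\<forall>a\<in>arcs N. \<forall>i\<in>{1..n}. 0 \<le> x a i) \<and>
       (\<forall>v\<in>W. \<forall>i\<in>{0..n}. 0 \<le> y v i) \<and>
       (\<forall>v\<in>verts N - (W \<union> {src, snk}). \<forall>i\<in>{1..n}.
          (\<Sum>a\<in>out_arcs N v. x a i) = (\<Sum>a\<in>in_arcs N v. x a i)) \<and>
       (\<forall>v\<in>W. \<forall>i\<in>{1..n}.
          (\<Sum>a\<in>out_arcs N v. x a i) + y v i = (\<Sum>a\<in>in_arcs N v. x a i) + y v (i - 1)) \<and>
       (\<forall>a\<in>arcs N - A1. \<forall>i\<in>{1..n}. x a i \<le> (\<tau> i - \<tau> (i - 1)) * cap a) \<and>
       (\<forall>a\<in>A1. \<forall>i\<in>{1..n} - outage p ts a. x a i \<le> (\<tau> i - \<tau> (i - 1)) * cap a) \<and>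
       (\<forall>a\<in>A1. \<forall>i\<in>outage p ts a. x a i = 0) \<and>
       (\<forall>v\<in>W. \<forall>i\<in>{0..n}. y v i \<le> scap v) \<and>
       (\<forall>v\<in>W. y v 0 = 0 \<and> y v n = 0))"

definition throughput :: "('e \<Rightarrow> real) \<Rightarrow> ('e \<Rightarrow> real) \<Rightarrow> ('e \<Rightarrow> nat \<Rightarrow> real) \<Rightarrow> real" where
  "throughput p ts x = (\<Sum>i = 1..num_intervals p ts.
     (\<Sum>a\<in>out_arcs N src. x a i) - (\<Sum>a\<in>in_arcs N src. x a i))"

text \<open>
  For feasible start times the maximum exists: the zero flow is feasible, and the capacities bound
  all variables.
\<close>

definition val :: "('e \<Rightarrow> real) \<Rightarrow> ('e \<Rightarrow> real) \<Rightarrow> real" where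
  "val p ts = (GREATEST z. \<exists>x y. feasible_flow p ts x y \<and> z = throughput p ts x)"

definition optimal_solution ::
    "('e \<Rightarrow> real) \<Rightarrow> ('e \<Rightarrow> real) \<Rightarrow> ('e \<Rightarrow> real) \<Rightarrow> ('e \<Rightarrow> real) \<Rightarrow> bool" where
  "optimal_solution p r d ts \<longleftrightarrow> is_arg_max (val p) (\<lambda>ts. ts \<in> feasible_starts p r d) ts"

end

end

theory Submission
  imports Defs
begin

text \<open>
  Once the order in which the jobs start and end is fixed, choosing the event times together with
  the flow is a linear program with rational data; there are finitely many orders. To make the
  feasible regions closed, consecutive event times may coincide in these programs, which is
  harmless because an interval of length zero carries no flow and can be merged into a neighbour.
  Fourier--Motzkin elimination over a subfield \<open>K\<close> of the reals shows that a bounded linear program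
  over \<open>K\<close> attains its maximum at a point over \<open>K\<close>. For \<open>K = \<rat>\<close> this yields a rational optimal
  schedule; for \<open>K = \<real>\<close>, with release times and deadlines that pin down the given start times,
  it shows that the maximum defining \<open>val\<close> is attained. As \<open>T\<close> is fixed, there are only finitely many
  integer job parameters, so the denominators have a common multiple.
\<close>

section \<open>Affine forms and polyhedra over a subfield of the reals\<close>

locale real_subfield =
  fixes K :: "real set"
  assumes one_mem: "1 \<in> K"
    and diff_mem: "x \<in> K \<Longrightarrow> y \<in> K \<Longrightarrow> x - y \<in> K"
    and mult_mem: "x \<in> K \<Longrightarrow> y \<in> K \<Longrightarrow> x * y \<in> K"
    and inverse_mem: "x \<in> K \<Longrightarrow> inverse x \<in> K"
begin

lemma zero_mem: "0 \<in> K"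
  using diff_mem[OF one_mem one_mem] by simp

lemma uminus_mem: "x \<in> K \<Longrightarrow> - x \<in> K"
  using diff_mem[OF zero_mem] by simp

lemma add_mem: "x \<in> K \<Longrightarrow> y \<in> K \<Longrightarrow> x + y \<in> K"
  using diff_mem[of x "- y"] uminus_mem by simp

lemma divide_mem: "x \<in> K \<Longrightarrow> y \<in> K \<Longrightarrow> x / y \<in> K"
  by (simp add: divide_inverse mult_mem inverse_mem)

text \<open>Generated by rules instead of coefficient vectors, so that the constraints of a concrete
  linear program are recognised by introduction rules even over an infinite index type. The scalar
  of \<open>scale\<close> stands on the right, as in the capacity bounds
  \<open>(\<tau> i - \<tau> (i - 1)) * cap a\<close>.\<close>

inductive affine_form :: "(('i \<Rightarrow> real) \<Rightarrow> real) \<Rightarrow> bool" where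
  const: "c \<in> K \<Longrightarrow> affine_form (\<lambda>z. c)"
| coord: "affine_form (\<lambda>z. z j)"
| add: "affine_form f \<Longrightarrow> affine_form g \<Longrightarrow> affine_form (\<lambda>z. f z + g z)"
| scale: "c \<in> K \<Longrightarrow> affine_form f \<Longrightarrow> affine_form (\<lambda>z. f z * c)"

lemma affine_form_diff:
  assumes "affine_form f" "affine_form g"
  shows "affine_form (\<lambda>z. f z - g z)"
  using affine_form.add[OF assms(1) affine_form.scale[OF uminus_mem[OF one_mem] assms(2)]] by simp

lemma affine_form_divide:
  "c \<in> K \<Longrightarrow> affine_form f \<Longrightarrow> affine_form (\<lambda>z. f z / c)"
  unfolding divide_inverse by (intro affine_form.scale inverse_mem)

lemma affine_form_sum:
  assumes "\<And>a. a \<in> A \<Longrightarrow> affine_form (f a)"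
  shows "affine_form (\<lambda>z. \<Sum>a\<in>A. f a z)"
  using assms
  by (induction A rule: infinite_finite_induct)
    (auto intro: affine_form.add affine_form.const[OF zero_mem])

lemma affine_form_mem: "affine_form f \<Longrightarrow> (\<And>i. z i \<in> K) \<Longrightarrow> f z \<in> K"
  by (induction rule: affine_form.induct) (auto intro: add_mem mult_mem)

text \<open>The index type may be infinite; that each form sees only finitely many coordinates is
  what makes successive elimination terminate.\<close>

lemma affine_form_finite_support:
  "affine_form f \<Longrightarrow> \<exists>J. finite J \<and> (\<forall>z z'. (\<forall>i\<in>J. z i = z' i) \<longrightarrow> f z = f z')"
proof (induction rule: affine_form.induct)
  case (const c)
  then show ?case by auto
next
  case (coord j)
  then show ?case by (intro exI[of _ "{j}"]) auto
next
  case (add f g)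
  then obtain J J' where J: "finite J" "\<forall>z z'. (\<forall>i\<in>J. z i = z' i) \<longrightarrow> f z = f z'"
    and J': "finite J'" "\<forall>z z'. (\<forall>i\<in>J'. z i = z' i) \<longrightarrow> g z = g z'" by blast
  have "f z + g z = f z' + g z'" if "\<forall>i\<in>J \<union> J'. z i = z' i" for z z'
    using that J(2) J'(2) by (intro arg_cong2[where f = "(+)"]) blast+
  then show ?case
    using J(1) J'(1) by (intro exI[of _ "J \<union> J'"]) auto
next
  case (scale c f)
  then show ?case by metis
qed

text \<open>Isolates the coefficient of the coordinate to be eliminated. That the rest
  \<open>g\<close> is free of coordinate \<open>j\<close> is expressed as invariance under updates
  at \<open>j\<close>.\<close>

lemma affine_form_split:
  "affine_form f \<Longrightarrow> \<exists>c g. c \<in> K \<and> affine_form g \<and> (\<forall>z v. g (z(j := v)) = g z) \<and>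
    (\<forall>z. f z = g z + z j * c)"
proof (induction rule: affine_form.induct)
  case (const c)
  then show ?case
    by (intro exI[of _ 0] exI[of _ "\<lambda>_. c"]) (auto intro: affine_form.const zero_mem)
next
  case (coord k)
  show ?case
  proof (cases "k = j")
    case True
    then show ?thesis
      by (intro exI[of _ 1] exI[of _ "\<lambda>_. 0"]) (auto intro: affine_form.const zero_mem one_mem)
  next
    case False
    then show ?thesis
      by (intro exI[of _ 0] exI[of _ "\<lambda>z. z k"]) (auto intro: affine_form.coord zero_mem)
  qed
next
  case (add f1 f2)
  then obtain c1 g1 c2 g2 where
    "c1 \<in> K" "affine_form g1" "\<forall>z v. g1 (z(j := v)) = g1 z" "\<forall>z. f1 z = g1 z + z j * c1"
    "c2 \<in> K" "affine_form g2" "\<forall>z v. g2 (z(j := v)) = g2 z" "\<forall>z. f2 z = g2 z + z j * c2"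
    by (elim exE conjE) blast
  then show ?case
    by (intro exI[of _ "c1 + c2"] exI[of _ "\<lambda>z. g1 z + g2 z"])
      (auto intro: affine_form.add add_mem simp: distrib_left simp del: fun_upd_apply)
next
  case (scale c' f)
  then obtain c g where
    "c \<in> K" "affine_form g" "\<forall>z v. g (z(j := v)) = g z" "\<forall>z. f z = g z + z j * c"
    by (elim exE conjE) blast
  with scale.hyps show ?case
    by (intro exI[of _ "c * c'"] exI[of _ "\<lambda>z. g z * c'"])
      (auto intro: affine_form.scale mult_mem simp: distrib_right simp del: fun_upd_apply)
qed

text \<open>A predicate on assignments, so that projecting out a coordinate is an existential
  quantifier over an updated assignment.\<close>

definition polyhedral :: "(('i \<Rightarrow> real) \<Rightarrow> bool) \<Rightarrow> bool" where
  "polyhedral P \<longleftrightarrow> (\<exists>F. finite F \<and> (\<forall>f\<in>F. affine_form f) \<and> (\<forall>z. P z \<longleftrightarrow> (\<forall>f\<in>F. 0 \<le> f z)))"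

lemma polyhedral_le:
  assumes "affine_form f" "affine_form g"
  shows "polyhedral (\<lambda>z. f z \<le> g z)"
  unfolding polyhedral_def
  by (intro exI[of _ "{\<lambda>z. g z - f z}"]) (auto intro: affine_form_diff assms)

lemma polyhedral_conj:
  assumes "polyhedral P" "polyhedral Q"
  shows "polyhedral (\<lambda>z. P z \<and> Q z)"
proof -
  obtain F G where "finite F" "\<forall>f\<in>F. affine_form f" "\<forall>z. P z \<longleftrightarrow> (\<forall>f\<in>F. 0 \<le> f z)"
    "finite G" "\<forall>f\<in>G. affine_form f" "\<forall>z. Q z \<longleftrightarrow> (\<forall>f\<in>G. 0 \<le> f z)"
    using assms unfolding polyhedral_def by metis
  then show ?thesis
    unfolding polyhedral_def by (intro exI[of _ "F \<union> G"]) auto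
qed

lemma polyhedral_eq:
  assumes "affine_form f" "affine_form g"
  shows "polyhedral (\<lambda>z. f z = g z)"
  unfolding order_eq_iff by (intro polyhedral_conj polyhedral_le assms)

lemma polyhedral_ball:
  assumes "finite A" "\<And>a. a \<in> A \<Longrightarrow> polyhedral (P a)"
  shows "polyhedral (\<lambda>z. \<forall>a\<in>A. P a z)"
  using assms
proof (induction A)
  case empty
  then show ?case by (auto simp: polyhedral_def intro: exI[of _ "{}"])
next
  case (insert a A)
  then show ?case by (auto intro: polyhedral_conj)
qed

lemma polyhedral_finite_support:
  assumes "polyhedral P"
  obtains J where "finite J" "\<And>z z'. (\<And>i. i \<in> J \<Longrightarrow> z i = z' i) \<Longrightarrow> P z = P z'"
proof -
  obtain F where F: "finite F" "\<forall>f\<in>F. affine_form f" "\<forall>z. P z \<longleftrightarrow> (\<forall>f\<in>F. 0 \<le> f z)"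
    using assms unfolding polyhedral_def by blast
  have "\<forall>f\<in>F. \<exists>J. finite J \<and> (\<forall>z z'. (\<forall>i\<in>J. z i = z' i) \<longrightarrow> f z = f z')"
    using F(2) affine_form_finite_support by blast
  then obtain J where J: "\<forall>f\<in>F. finite (J f) \<and> (\<forall>z z'. (\<forall>i\<in>J f. z i = z' i) \<longrightarrow> f z = f z')"
    by metis
  show ?thesis
  proof (rule that[of "\<Union>f\<in>F. J f"])
    show "finite (\<Union>f\<in>F. J f)" using F(1) J by blast
    fix z z' :: "'a \<Rightarrow> real"
    assume z: "\<And>i. i \<in> (\<Union>f\<in>F. J f) \<Longrightarrow> z i = z' i"
    have "f z = f z'" if "f \<in> F" for f
    proof -
      have "\<forall>i\<in>J f. z i = z' i" using z that by blast
      then show ?thesis using J that by blast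
    qed
    then have "(\<forall>f\<in>F. 0 \<le> f z) \<longleftrightarrow> (\<forall>f\<in>F. 0 \<le> f z')" by metis
    then show "P z = P z'" using F(3) by blast
  qed
qed

section \<open>Fourier-Motzkin elimination\<close>

text \<open>The largest lower bound serves, or the least upper bound if there are no lower bounds,
  or 0 if there are no bounds at all; each choice stays in \<open>K\<close> when the bounds
  do.\<close>

lemma separating_mem:
  assumes "finite L" "finite U" "\<forall>l\<in>L. \<forall>u\<in>U. l \<le> (u::real)"
  shows "\<exists>v. (\<forall>l\<in>L. l \<le> v) \<and> (\<forall>u\<in>U. v \<le> u) \<and> (L \<union> U \<subseteq> K \<longrightarrow> v \<in> K)"
proof (cases "L = {}")
  case False
  then have "Max L \<in> L" using assms(1) by simp
  with assms show ?thesis by (intro exI[of _ "Max L"]) auto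
next
  case L: True
  show ?thesis
  proof (cases "U = {}")
    case False
    then have "Min U \<in> U" using assms(2) by simp
    with L assms show ?thesis by (intro exI[of _ "Min U"]) auto
  next
    case True
    with L zero_mem show ?thesis by (intro exI[of _ 0]) auto
  qed
qed

text \<open>Each constraint bounds \<open>z j\<close> from below, from above, or not at all,
  according to the sign of its coefficient. A suitable value exists iff every lower bound is at most
  every upper bound, and these comparisons are again affine over \<open>K\<close>. At a point over
  \<open>K\<close> the bounds lie in \<open>K\<close>, hence so does a suitable value.\<close>

lemma fourier_motzkin:
  assumes "polyhedral P"
  shows "polyhedral (\<lambda>z. \<exists>v. P (z(j := v)))"
    and "P (z(j := v)) \<Longrightarrow> (\<And>i. z i \<in> K) \<Longrightarrow> \<exists>v\<in>K. P (z(j := v))"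
proof -
  obtain F where F: "finite F" "\<forall>f\<in>F. affine_form f" "\<forall>z. P z \<longleftrightarrow> (\<forall>f\<in>F. 0 \<le> f z)"
    using assms unfolding polyhedral_def by blast
  have "\<forall>f\<in>F. \<exists>c g. c \<in> K \<and> affine_form g \<and> (\<forall>z v. g (z(j := v)) = g z) \<and>
    (\<forall>z. f z = g z + z j * c)"
    by (intro ballI affine_form_split) (use F(2) in blast)
  then obtain c g where "\<forall>f\<in>F. c f \<in> K \<and> affine_form (g f) \<and> (\<forall>z v. g f (z(j := v)) = g f z) \<and>
    (\<forall>z. f z = g f z + z j * c f)"
    unfolding bchoice_iff by (elim exE)
  then have cg: "\<And>f. f \<in> F \<Longrightarrow> c f \<in> K" "\<And>f. f \<in> F \<Longrightarrow> affine_form (g f)"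
    "\<And>f z v. f \<in> F \<Longrightarrow> g f (z(j := v)) = g f z" "\<And>f z. f \<in> F \<Longrightarrow> f z = g f z + z j * c f"
    by simp_all
  define F0 Fp Fn where "F0 = {f \<in> F. c f = 0}" and "Fp = {f \<in> F. 0 < c f}"
    and "Fn = {f \<in> F. c f < 0}"
  \<comment> \<open>\<open>b f z\<close> is the root in \<open>v\<close> of
    \<open>g f z + v * c f\<close>: a lower bound for \<open>v\<close> if \<open>f\<close> is in
    \<open>Fp\<close>, an upper bound if \<open>f\<close> is in \<open>Fn\<close>.\<close>
  define b where "b f z = g f z / (- c f)" for f z
  define Q where "Q z \<longleftrightarrow> (\<forall>f\<in>F0. 0 \<le> g f z) \<and> (\<forall>f\<in>Fp. \<forall>h\<in>Fn. b f z \<le> b h z)" for z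
  have fin: "finite F0" "finite Fp" "finite Fn"
    using F(1) by (auto simp: F0_def Fp_def Fn_def)
  have P_iff: "P (z(j := v)) \<longleftrightarrow>
    (\<forall>f\<in>F0. 0 \<le> g f z) \<and> (\<forall>f\<in>Fp. b f z \<le> v) \<and> (\<forall>f\<in>Fn. v \<le> b f z)" for z v
  proof -
    have "0 \<le> f (z(j := v)) \<longleftrightarrow>
      (c f = 0 \<longrightarrow> 0 \<le> g f z) \<and> (0 < c f \<longrightarrow> b f z \<le> v) \<and> (c f < 0 \<longrightarrow> v \<le> b f z)"
      if "f \<in> F" for f
      using that cg(3,4)[OF that]
      by (cases "c f" "0::real" rule: linorder_cases) (auto simp: b_def field_simps)
    then show ?thesis
      unfolding F(3)[rule_format] F0_def Fp_def Fn_def by auto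
  qed
  \<comment> \<open>Membership in \<open>K\<close> is kept as an implication, so one witness serves
    both claims: arbitrary real points for the projection, points over \<open>K\<close> for the
    second.\<close>
  have witness: "\<exists>v. P (z(j := v)) \<and> ((\<forall>i. z i \<in> K) \<longrightarrow> v \<in> K)" if "Q z" for z
  proof -
    have le: "\<forall>l\<in>(\<lambda>f. b f z) ` Fp. \<forall>u\<in>(\<lambda>f. b f z) ` Fn. l \<le> u"
      using \<open>Q z\<close> by (simp add: Q_def)
    obtain v where v: "\<forall>l\<in>(\<lambda>f. b f z) ` Fp. l \<le> v" "\<forall>u\<in>(\<lambda>f. b f z) ` Fn. v \<le> u"
      "(\<lambda>f. b f z) ` Fp \<union> (\<lambda>f. b f z) ` Fn \<subseteq> K \<longrightarrow> v \<in> K"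
      using separating_mem[OF finite_imageI[OF fin(2)] finite_imageI[OF fin(3)] le] by metis
    have "b f z \<in> K" if "f \<in> F" "\<forall>i. z i \<in> K" for f
      unfolding b_def using that cg(1,2) by (auto intro!: divide_mem uminus_mem affine_form_mem[of "g f" z])
    then have "v \<in> K" if "\<forall>i. z i \<in> K"
      using v(3) that by (auto simp: Fp_def Fn_def)
    moreover have "P (z(j := v))"
      unfolding P_iff using v(1,2) \<open>Q z\<close> by (simp add: Q_def)
    ultimately show ?thesis by (intro exI[of _ v] conjI) simp_all
  qed
  have Q_iff: "Q z \<longleftrightarrow> (\<exists>v. P (z(j := v)))" for z
  proof
    show "\<exists>v. P (z(j := v))" if "Q z" using witness[OF that] by (elim exE conjE) (rule exI)
    show "Q z" if "\<exists>v. P (z(j := v))"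
      using that unfolding P_iff Q_def by (elim exE) (meson order_trans)
  qed
  have "polyhedral Q"
    unfolding Q_def b_def using cg(1,2) fin
    by (intro polyhedral_conj polyhedral_ball polyhedral_le affine_form_divide affine_form.const
        zero_mem uminus_mem) (auto simp: F0_def Fp_def Fn_def)
  then show "polyhedral (\<lambda>z. \<exists>v. P (z(j := v)))"
    by (simp flip: Q_iff)
  show "\<exists>v\<in>K. P (z(j := v))" if "P (z(j := v))" "\<And>i. z i \<in> K" for z v
    using witness Q_iff that by blast
qed

section \<open>Maxima attained over the subfield\<close>

text \<open>Projecting out the coordinates other than \<open>j\<close> one at a time leaves the
  possible values of the objective \<open>z j\<close> unchanged and ends in a problem in one
  variable. Its maximum is the least upper bound given by a constraint, which lies in
  \<open>K\<close>; the eliminated coordinates are then restored with values in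
  \<open>K\<close>.\<close>

lemma polyhedral_max_aux:
  assumes "finite J" "j \<notin> J" "polyhedral P"
    and "\<And>z z'. (\<And>i. i \<in> insert j J \<Longrightarrow> z i = z' i) \<Longrightarrow> P z = P z'"
    and "P z0" "\<And>z. P z \<Longrightarrow> z j \<le> B"
  shows "\<exists>z. P z \<and> (\<forall>i. z i \<in> K) \<and> (\<forall>z'. P z' \<longrightarrow> z' j \<le> z j)"
  using assms
proof (induction J arbitrary: P z0)
  case empty
  obtain F where F: "finite F" "\<forall>f\<in>F. affine_form f" "\<forall>z. P z \<longleftrightarrow> (\<forall>f\<in>F. 0 \<le> f z)"
    using empty.prems unfolding polyhedral_def by blast
  \<comment> \<open>Only coordinate \<open>j\<close> matters to \<open>P\<close> here, so all others
    may be set to 0, an element of \<open>K\<close>.\<close>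
  define w where "w v = (\<lambda>i. if i = j then v else 0::real)" for v
  have P_w: "P z \<longleftrightarrow> P (w (z j))" for z
    using empty.prems(3)[of z "w (z j)"] by (simp add: w_def)
  have "\<forall>f\<in>F. \<exists>c q. c \<in> K \<and> q \<in> K \<and> (\<forall>v. f (w v) = q + v * c)"
  proof
    fix f assume "f \<in> F"
    then have "affine_form f" using F(2) by blast
    from affine_form_split[OF this, of j] obtain c g where
      "c \<in> K" "affine_form g" "\<forall>z v. g (z(j := v)) = g z" "\<forall>z. f z = g z + z j * c"
      by (elim exE conjE)
    moreover have "w v = (w 0)(j := v)" for v by (auto simp: w_def)
    moreover have "g (w 0) \<in> K"
      using \<open>affine_form g\<close> by (rule affine_form_mem) (simp add: w_def zero_mem)
    ultimately have "f (w v) = g (w 0) + v * c" for v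
      by (metis fun_upd_same)
    with \<open>c \<in> K\<close> \<open>g (w 0) \<in> K\<close> show "\<exists>c q. c \<in> K \<and> q \<in> K \<and> (\<forall>v. f (w v) = q + v * c)"
      by blast
  qed
  then obtain c q where "\<forall>f\<in>F. c f \<in> K \<and> q f \<in> K \<and> (\<forall>v. f (w v) = q f + v * c f)"
    unfolding bchoice_iff by (elim exE)
  then have cq: "\<And>f. f \<in> F \<Longrightarrow> c f \<in> K" "\<And>f. f \<in> F \<Longrightarrow> q f \<in> K"
    "\<And>f v. f \<in> F \<Longrightarrow> f (w v) = q f + v * c f"
    by simp_all
  have P_iff: "P (w v) \<longleftrightarrow> (\<forall>f\<in>F. 0 \<le> q f + v * c f)" for v
    using F(3) cq(3) by simp
  define U where "U = (\<lambda>f. q f / (- c f)) ` {f \<in> F. c f < 0}"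
  have fin: "finite U" using F(1) by (simp add: U_def)
  have le_U: "v \<le> u" if v: "P (w v)" and u: "u \<in> U" for u v
  proof -
    obtain f where f: "f \<in> F" "c f < 0" "u = q f / (- c f)"
      using u by (auto simp: U_def)
    then have "0 \<le> q f + v * c f" using v P_iff by blast
    then show ?thesis using f(2) by (simp add: f(3) field_simps)
  qed
  have "U \<noteq> {}"
  proof
    assume "U = {}"
    then have pos: "0 \<le> c f" if "f \<in> F" for f using that by (auto simp: U_def not_less[symmetric])
    \<comment> \<open>With no negative coefficient, increasing the objective from the feasible value
      \<open>z0 j\<close> violates nothing, so a value above \<open>B\<close> would be
      feasible.\<close>
    have "P (w (max (z0 j) (B + 1)))"
      unfolding P_iff
    proof
      fix f assume f: "f \<in> F"
      have "0 \<le> q f + z0 j * c f" using f P_iff P_w empty.prems(4) by blast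
      also have "\<dots> \<le> q f + max (z0 j) (B + 1) * c f"
        using pos[OF f] by (intro add_left_mono mult_right_mono) auto
      finally show "0 \<le> q f + max (z0 j) (B + 1) * c f" .
    qed
    then show False using empty.prems(5) by (fastforce simp: w_def)
  qed
  then have M: "Min U \<in> U" using fin by simp
  have "U \<subseteq> K" by (auto simp: U_def intro!: uminus_mem divide_mem cq)
  with M have MK: "Min U \<in> K" by blast
  have z0_le: "z0 j \<le> Min U" using le_U M P_w empty.prems(4) by blast
  \<comment> \<open>Constraints with negative coefficient hold because \<open>Min U\<close> is below
    each of their bounds; the others hold at \<open>z0 j\<close> and are preserved on moving up to
    \<open>Min U\<close>.\<close>
  have "P (w (Min U))"
    unfolding P_iff
  proof
    fix f assume f: "f \<in> F"
    show "0 \<le> q f + Min U * c f"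
    proof (cases "c f < 0")
      case True
      then have "Min U \<le> q f / (- c f)" using f fin by (auto simp: U_def)
      then show ?thesis using True by (simp add: field_simps)
    next
      case False
      have "0 \<le> q f + z0 j * c f" using f P_iff P_w empty.prems(4) by blast
      also have "\<dots> \<le> q f + Min U * c f"
        using False z0_le by (intro add_left_mono mult_right_mono) auto
      finally show ?thesis .
    qed
  qed
  moreover have "\<forall>i. w (Min U) i \<in> K" using MK by (simp add: w_def zero_mem)
  moreover have "z' j \<le> w (Min U) j" if "P z'" for z'
    using le_U M P_w that by (simp add: w_def)
  ultimately show ?case by blast
next
  case (insert k J)
  define Q where "Q z \<longleftrightarrow> (\<exists>v. P (z(k := v)))" for z
  have kj: "k \<noteq> j" using insert.prems(1) by auto
  have Q_of_P: "Q z" if "P z" for z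
    unfolding Q_def using that by (intro exI[of _ "z k"]) simp
  have "\<exists>z. Q z \<and> (\<forall>i. z i \<in> K) \<and> (\<forall>z'. Q z' \<longrightarrow> z' j \<le> z j)"
  proof (rule insert.IH)
    show "j \<notin> J" using insert.prems(1) by simp
    show "polyhedral Q" unfolding Q_def by (rule fourier_motzkin(1)[OF insert.prems(2)])
    show "Q z0" by (rule Q_of_P[OF insert.prems(4)])
    show "z j \<le> B" if Qz: "Q z" for z
    proof -
      obtain v where "P (z(k := v))" using Qz by (auto simp: Q_def)
      from insert.prems(5)[OF this] kj show ?thesis by simp
    qed
    show "Q z = Q z'" if eq: "\<And>i. i \<in> insert j J \<Longrightarrow> z i = z' i" for z z'
    proof -
      have "P (z(k := v)) = P (z'(k := v))" for v
        by (rule insert.prems(3)) (use eq in auto)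
      then show ?thesis by (simp add: Q_def)
    qed
  qed
  then obtain z where z: "Q z" "\<And>i. z i \<in> K" "\<And>z'. Q z' \<Longrightarrow> z' j \<le> z j" by blast
  \<comment> \<open>Back-substitution: the optimum of the projection is over \<open>K\<close>, so
    coordinate \<open>k\<close> can also be given a value in \<open>K\<close>.\<close>
  obtain v where v: "v \<in> K" "P (z(k := v))"
    using z(1,2) fourier_motzkin(2)[OF insert.prems(2)] unfolding Q_def by metis
  show ?case
  proof (intro exI conjI)
    show "P (z(k := v))" by (rule v(2))
    show "\<forall>i. (z(k := v)) i \<in> K" using v(1) z(2) by simp
    show "\<forall>z'. P z' \<longrightarrow> z' j \<le> (z(k := v)) j" using z(3) Q_of_P kj by simp
  qed
qed

text \<open>A coordinate as objective loses no generality: an equation among the constraints can tie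
  it to any affine form. The maximum is attained by elimination, without a compactness
  argument.\<close>

theorem polyhedral_max:
  assumes "polyhedral P" "P z0" "\<And>z. P z \<Longrightarrow> z j \<le> B"
  shows "\<exists>z. P z \<and> (\<forall>i. z i \<in> K) \<and> (\<forall>z'. P z' \<longrightarrow> z' j \<le> z j)"
proof -
  obtain J where J: "finite J" "\<And>z z'. (\<And>i. i \<in> J \<Longrightarrow> z i = z' i) \<Longrightarrow> P z = P z'"
    using polyhedral_finite_support[OF assms(1)] by blast
  show ?thesis
  proof (rule polyhedral_max_aux[of "J - {j}" j P z0 B])
    show "finite (J - {j})" "j \<notin> J - {j}" using J(1) by auto
    show "polyhedral P" "P z0" by (fact assms(1,2))+
    show "z j \<le> B" if "P z" for z by (rule assms(3)[OF that])
    show "P z = P z'" if "\<And>i. i \<in> insert j (J - {j}) \<Longrightarrow> z i = z' i" for z z'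
      by (rule J(2)) (use that in auto)
  qed
qed

end

section \<open>Sums over consecutive blocks of indices\<close>

text \<open>As \<open>k\<close> is nondecreasing from 0, the blocks, some possibly empty, tile
  \<open>{1..k m}\<close>.\<close>

lemma sum_Ioc_split:
  fixes f :: "nat \<Rightarrow> real" and k :: "nat \<Rightarrow> nat"
  assumes "\<And>j. j \<in> {1..m} \<Longrightarrow> k (j - 1) \<le> k j" "k 0 = 0"
  shows "(\<Sum>j = 1..m. \<Sum>i\<in>{k (j - 1)<..k j}. f i) = (\<Sum>i = 1..k m. f i)"
  using assms
proof (induction m)
  case 0
  then show ?case by simp
next
  case (Suc m)
  have "k m \<le> k (Suc m)" using Suc.prems(1)[of "Suc m"] by simp
  then have "{1..k (Suc m)} = {1..k m} \<union> {k m<..k (Suc m)}" by auto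
  moreover have "(\<Sum>j = 1..m. \<Sum>i\<in>{k (j - 1)<..k j}. f i) = (\<Sum>i = 1..k m. f i)"
    by (rule Suc.IH) (use Suc.prems in simp_all)
  ultimately show ?case by (simp add: sum.union_disjoint ivl_disj_int)
qed

lemma sum_Ioc_telescope:
  fixes f :: "nat \<Rightarrow> real"
  assumes "l \<le> m"
  shows "(\<Sum>i\<in>{l<..m}. f i - f (i - 1)) = f m - f l"
  using assms
proof (induction m rule: dec_induct)
  case (step m)
  then have "{l<..Suc m} = insert (Suc m) {l<..m}" by auto
  with step show ?case by simp
qed simp

section \<open>Flows on a grid of time points\<close>

context maintenance_network
begin

lemma finite_jobs: "finite A1"
  using jobs_subset finite_arcs finite_subset by blast

lemma finite_storage: "finite W"
  using storage_subset finite_verts finite_subset by blast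

text \<open>The constraints of \<open>feasible_flow\<close> with the grid and the outage intervals
  as free parameters. Nothing forces the grid points to be distinct or to be the event times of a
  schedule, so the same definition serves the linear programs.\<close>

definition grid_flow ::
    "nat \<Rightarrow> (nat \<Rightarrow> real) \<Rightarrow> ('e \<Rightarrow> nat set) \<Rightarrow> ('e \<Rightarrow> nat \<Rightarrow> real) \<Rightarrow> ('v \<Rightarrow> nat \<Rightarrow> real) \<Rightarrow> bool" where
  "grid_flow n \<tau> Off x y \<longleftrightarrow>
     (\<forall>a\<in>arcs N. \<forall>i\<in>{1..n}. 0 \<le> x a i) \<and>
     (\<forall>v\<in>W. \<forall>i\<in>{0..n}. 0 \<le> y v i) \<and>
     (\<forall>v\<in>verts N - (W \<union> {src, snk}). \<forall>i\<in>{1..n}.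
        (\<Sum>a\<in>out_arcs N v. x a i) = (\<Sum>a\<in>in_arcs N v. x a i)) \<and>
     (\<forall>v\<in>W. \<forall>i\<in>{1..n}.
        (\<Sum>a\<in>out_arcs N v. x a i) + y v i = (\<Sum>a\<in>in_arcs N v. x a i) + y v (i - 1)) \<and>
     (\<forall>a\<in>arcs N - A1. \<forall>i\<in>{1..n}. x a i \<le> (\<tau> i - \<tau> (i - 1)) * cap a) \<and>
     (\<forall>a\<in>A1. \<forall>i\<in>{1..n} - Off a. x a i \<le> (\<tau> i - \<tau> (i - 1)) * cap a) \<and>
     (\<forall>a\<in>A1. \<forall>i\<in>Off a. x a i = 0) \<and>
     (\<forall>v\<in>W. \<forall>i\<in>{0..n}. y v i \<le> scap v) \<and>
     (\<forall>v\<in>W. y v 0 = 0 \<and> y v n = 0)"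

definition net_outflow :: "nat \<Rightarrow> ('e \<Rightarrow> nat \<Rightarrow> real) \<Rightarrow> real" where
  "net_outflow n x = (\<Sum>i = 1..n. (\<Sum>a\<in>out_arcs N src. x a i) - (\<Sum>a\<in>in_arcs N src. x a i))"

lemma feasible_flow_iff:
  "feasible_flow p ts x y \<longleftrightarrow>
    grid_flow (num_intervals p ts) (event_time p ts) (outage p ts) x y"
  by (simp add: feasible_flow_def grid_flow_def Let_def)

lemma throughput_eq: "throughput p ts x = net_outflow (num_intervals p ts) x"
  by (simp add: throughput_def net_outflow_def)

text \<open>During an outage the flow is 0, which also obeys the capacity bound because the grid is
  nondecreasing.\<close>

lemma grid_flow_le_cap:
  assumes "grid_flow n \<tau> Off x y" "\<forall>i\<in>{1..n}. \<tau> (i - 1) \<le> \<tau> i" "a \<in> arcs N" "i \<in> {1..n}"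
  shows "x a i \<le> (\<tau> i - \<tau> (i - 1)) * cap a"
proof -
  have "0 \<le> (\<tau> i - \<tau> (i - 1)) * cap a"
    using assms cap_nonneg by (intro mult_nonneg_nonneg) auto
  then show ?thesis
    using assms by (cases "a \<in> A1"; cases "i \<in> Off a") (auto simp: grid_flow_def)
qed

text \<open>Drop the flow entering the source and bound the flow leaving it by capacities; the
  interval lengths add up to \<open>T\<close>. This is the bound that keeps the linear programs
  bounded.\<close>

lemma net_outflow_le:
  assumes flow: "grid_flow n \<tau> Off x y" and mono: "\<forall>i\<in>{1..n}. \<tau> (i - 1) \<le> \<tau> i"
    and ends: "\<tau> 0 = 0" "\<tau> n = T"
  shows "net_outflow n x \<le> T * (\<Sum>a\<in>out_arcs N src. cap a)"
proof -
  have "net_outflow n x \<le> (\<Sum>i = 1..n. \<Sum>a\<in>out_arcs N src. (\<tau> i - \<tau> (i - 1)) * cap a)"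
    unfolding net_outflow_def
  proof (intro sum_mono)
    fix i assume i: "i \<in> {1..n}"
    have "0 \<le> (\<Sum>a\<in>in_arcs N src. x a i)"
      using flow i by (intro sum_nonneg) (auto simp: grid_flow_def)
    moreover have "(\<Sum>a\<in>out_arcs N src. x a i) \<le> (\<Sum>a\<in>out_arcs N src. (\<tau> i - \<tau> (i - 1)) * cap a)"
      by (intro sum_mono grid_flow_le_cap[OF flow mono _ i]) auto
    ultimately show "(\<Sum>a\<in>out_arcs N src. x a i) - (\<Sum>a\<in>in_arcs N src. x a i)
      \<le> (\<Sum>a\<in>out_arcs N src. (\<tau> i - \<tau> (i - 1)) * cap a)" by linarith
  qed
  also have "\<dots> = (\<Sum>i = 1..n. \<tau> i - \<tau> (i - 1)) * (\<Sum>a\<in>out_arcs N src. cap a)"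
    unfolding sum_distrib_right by (intro sum.cong refl) (simp add: sum_distrib_left)
  also have "(\<Sum>i = 1..n. \<tau> i - \<tau> (i - 1)) = T"
  proof -
    have "(\<Sum>i = 1..m. \<tau> i - \<tau> (i - 1)) = \<tau> m - \<tau> 0" for m
      by (induction m) auto
    then show ?thesis using ends by simp
  qed
  finally show ?thesis .
qed

section \<open>Event times of a schedule\<close>

lemma event_times_subset:
  assumes "valid_jobs p r d" "ts \<in> feasible_starts p r d"
  shows "event_times p ts \<subseteq> {0..T}"
proof -
  have "0 \<le> ts a" "0 < p a" "ts a + p a \<le> T" if "a \<in> A1" for a
    using assms that PiE_mem[of ts A1 "\<lambda>a. {r a..d a - p a}" a]
    by (fastforce simp: valid_jobs_def feasible_starts_def)+
  then show ?thesis
    using horizon_pos by (fastforce simp: event_times_def)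
qed

lemma finite_event_times: "finite (event_times p ts)"
  by (simp add: event_times_def finite_jobs)

text \<open>Two event times per job, together with 0 and \<open>T\<close>. The bound does not
  involve the start times, so only finitely many orders of events arise.\<close>

lemma num_intervals_le: "num_intervals p ts \<le> 2 * card A1 + 1"
proof -
  have "card (event_times p ts) \<le> card (ts ` A1) + card ((\<lambda>a. ts a + p a) ` A1) + card {0, T}"
    unfolding event_times_def by (meson card_Un_le order_trans add_right_mono)
  also have "\<dots> \<le> card A1 + card A1 + 2"
    by (intro add_mono card_image_le finite_jobs) (simp add: card_insert_if)
  finally show ?thesis by (simp add: num_intervals_def)
qed

text \<open>All event times lie in \<open>{0..T}\<close> and both end points are among them, so the
  sorted enumeration must begin with 0 and end with \<open>T\<close>.\<close>

lemma
  assumes "valid_jobs p r d" "ts \<in> feasible_starts p r d"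
  shows event_time_strict_mono: "strict_mono_on {0..num_intervals p ts} (event_time p ts)"
    and event_time_image: "event_time p ts ` {0..num_intervals p ts} = event_times p ts"
    and event_time_0: "event_time p ts 0 = 0"
    and event_time_last: "event_time p ts (num_intervals p ts) = T"
    and num_intervals_pos: "0 < num_intervals p ts"
proof -
  let ?E = "event_times p ts" and ?n = "num_intervals p ts" and ?\<tau> = "event_time p ts"
  have sub: "{0, T} \<subseteq> ?E" by (auto simp: event_times_def)
  then have "card {0, T} \<le> card ?E" by (intro card_mono finite_event_times)
  \<comment> \<open>Since 0 and \<open>T\<close> are distinct, the truncated subtraction in
    \<open>num_intervals\<close> is exact and leaves at least one interval.\<close>
  then have card: "card ?E = Suc ?n" "0 < ?n"
    using horizon_pos by (auto simp: num_intervals_def)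
  show "0 < ?n" by (rule card(2))
  show mono: "strict_mono_on {0..?n} ?\<tau>"
    unfolding event_time_def using card(1)
    by (intro strict_mono_onI)
      (auto intro!: sorted_wrt_nth_less[OF strict_sorted_list_of_set] simp: finite_event_times)
  have "?E = set (sorted_list_of_set ?E)" by (simp add: finite_event_times)
  also have "\<dots> = ?\<tau> ` {0..?n}"
    unfolding event_time_def using card(1)
    by (auto simp: set_conv_nth image_iff less_Suc_eq_le)
  finally show image: "?\<tau> ` {0..?n} = ?E" by simp
  have le: "?\<tau> i \<le> ?\<tau> j" if "i \<le> j" "j \<le> ?n" for i j
    using strict_mono_on_leD[OF mono, of i j] that by simp
  note range = event_times_subset[OF assms]
  obtain i where "i \<le> ?n" "?\<tau> i = 0" using sub image by (metis (no_types) atLeastAtMost_iff imageE insert_subset)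
  moreover have "?\<tau> 0 \<in> {0..T}" using image range by fastforce
  ultimately show "?\<tau> 0 = 0" using le[of 0 i] by simp
  obtain i where "i \<le> ?n" "?\<tau> i = T" using sub image by (metis (no_types) atLeastAtMost_iff imageE insert_subset)
  moreover have "?\<tau> ?n \<in> {0..T}" using image range by fastforce
  ultimately show "?\<tau> ?n = T" using le[of i ?n] by simp
qed

text \<open>
  The intervals between the grid points \<open>k (j - 1)\<close> and \<open>k j\<close> are merged. Since intervals of length
  zero carry no flow, only the others have to respect the outages.
\<close>

lemma grid_flow_merge:
  assumes flow: "grid_flow n \<sigma> Off x y" and mono: "\<forall>i\<in>{1..n}. \<sigma> (i - 1) \<le> \<sigma> i"
    and k: "\<And>j. j \<in> {1..m} \<Longrightarrow> k (j - 1) \<le> k j" "\<And>j. j \<le> m \<Longrightarrow> k j \<le> n" "k 0 = 0" "k m = n"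
    and \<tau>: "\<And>j. j \<le> m \<Longrightarrow> \<sigma> (k j) = \<tau> j"
    and Off': "\<And>a. a \<in> A1 \<Longrightarrow> Off' a \<subseteq> {1..m}"
    and off: "\<And>a j i. a \<in> A1 \<Longrightarrow> j \<in> Off' a \<Longrightarrow> i \<in> {k (j - 1)<..k j} \<Longrightarrow>
      \<sigma> (i - 1) = \<sigma> i \<or> i \<in> Off a"
  defines "x' \<equiv> \<lambda>a j. \<Sum>i\<in>{k (j - 1)<..k j}. x a i"
  shows "grid_flow m \<tau> Off' x' (\<lambda>v j. y v (k j))" and "net_outflow m x' = net_outflow n x"
proof -
  have i_range: "i \<in> {1..n}" if "i \<in> {k (j - 1)<..k j}" "j \<in> {1..m}" for i j
    using that k(2)[of j] by auto
  have x'_nonneg: "0 \<le> x' a j" if "a \<in> arcs N" "j \<in> {1..m}" for a j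
    unfolding x'_def using flow i_range[OF _ that(2)] that(1)
    by (intro sum_nonneg) (auto simp: grid_flow_def)
  have x'_le: "x' a j \<le> (\<tau> j - \<tau> (j - 1)) * cap a" if "a \<in> arcs N" "j \<in> {1..m}" for a j
  proof -
    have "x' a j \<le> (\<Sum>i\<in>{k (j - 1)<..k j}. (\<sigma> i - \<sigma> (i - 1)) * cap a)"
      unfolding x'_def
      by (intro sum_mono grid_flow_le_cap[OF flow mono that(1)] i_range[OF _ that(2)])
    also have "\<dots> = (\<sigma> (k j) - \<sigma> (k (j - 1))) * cap a"
      by (simp only: sum_Ioc_telescope[OF k(1)[OF that(2)]] flip: sum_distrib_right)
    also have "\<dots> = (\<tau> j - \<tau> (j - 1)) * cap a"
    proof -
      have "j \<le> m" "j - 1 \<le> m" using that(2) by auto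
      then show ?thesis by (simp only: \<tau>)
    qed
    finally show ?thesis .
  qed
  have x'_off: "x' a j = 0" if a: "a \<in> A1" and j: "j \<in> Off' a" for a j
    unfolding x'_def
  proof (intro sum.neutral ballI)
    fix i assume i: "i \<in> {k (j - 1)<..k j}"
    have j': "j \<in> {1..m}" using Off' a j by blast
    have a': "a \<in> arcs N" using a jobs_subset by blast
    show "x a i = 0"
      using off[OF a j i]
    proof
      assume "\<sigma> (i - 1) = \<sigma> i"
      then have "x a i \<le> 0"
        using grid_flow_le_cap[OF flow mono a' i_range[OF i j']] by simp
      moreover have "0 \<le> x a i"
        using flow a' i_range[OF i j'] by (auto simp: grid_flow_def)
      ultimately show ?thesis by simp
    next
      assume "i \<in> Off a"
      then show ?thesis using flow a by (auto simp: grid_flow_def)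
    qed
  qed
  have sum_x': "(\<Sum>a\<in>B. x' a j) = (\<Sum>i\<in>{k (j - 1)<..k j}. \<Sum>a\<in>B. x a i)" for B j
    unfolding x'_def by (rule sum.swap)
  have balance: "(\<Sum>a\<in>out_arcs N v. x' a j) = (\<Sum>a\<in>in_arcs N v. x' a j)"
    if "v \<in> verts N - (W \<union> {src, snk})" "j \<in> {1..m}" for v j
    unfolding sum_x'
  proof (rule sum.cong[OF refl])
    fix i assume "i \<in> {k (j - 1)<..k j}"
    then show "(\<Sum>a\<in>out_arcs N v. x a i) = (\<Sum>a\<in>in_arcs N v. x a i)"
      using flow that(1) i_range[OF _ that(2)] by (auto simp: grid_flow_def)
  qed
  have storage: "(\<Sum>a\<in>out_arcs N v. x' a j) + y v (k j) = (\<Sum>a\<in>in_arcs N v. x' a j) + y v (k (j - 1))"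
    if "v \<in> W" "j \<in> {1..m}" for v j
  proof -
    \<comment> \<open>Adding the storage balances over a block makes the intermediate levels
      telescope, leaving only the levels at the two ends of the block.\<close>
    have "(\<Sum>i\<in>{k (j - 1)<..k j}. (\<Sum>a\<in>in_arcs N v. x a i) - (\<Sum>a\<in>out_arcs N v. x a i)) =
      (\<Sum>i\<in>{k (j - 1)<..k j}. y v i - y v (i - 1))"
    proof (rule sum.cong[OF refl])
      fix i assume "i \<in> {k (j - 1)<..k j}"
      then have "(\<Sum>a\<in>out_arcs N v. x a i) + y v i = (\<Sum>a\<in>in_arcs N v. x a i) + y v (i - 1)"
        using flow that(1) i_range[OF _ that(2)] by (auto simp: grid_flow_def)
      then show "(\<Sum>a\<in>in_arcs N v. x a i) - (\<Sum>a\<in>out_arcs N v. x a i) = y v i - y v (i - 1)"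
        by simp
    qed
    also have "\<dots> = y v (k j) - y v (k (j - 1))"
      by (rule sum_Ioc_telescope[OF k(1)[OF that(2)]])
    finally show ?thesis unfolding sum_x' sum_subtractf by linarith
  qed
  show "grid_flow m \<tau> Off' x' (\<lambda>v j. y v (k j))"
    unfolding grid_flow_def
  proof (intro conjI ballI)
    fix v i
    show "0 \<le> y v (k i)" if "v \<in> W" "i \<in> {0..m}"
      using flow that k(2)[of i] by (auto simp: grid_flow_def)
    show "y v (k i) \<le> scap v" if "v \<in> W" "i \<in> {0..m}"
      using flow that k(2)[of i] by (auto simp: grid_flow_def)
    show "y v (k 0) = 0" "y v (k m) = 0" if "v \<in> W"
      using flow that k(3,4) by (auto simp: grid_flow_def)
  qed (use x'_nonneg x'_le x'_off balance storage jobs_subset in auto)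
  show "net_outflow m x' = net_outflow n x"
    unfolding net_outflow_def sum_x' sum_subtractf[symmetric]
    using sum_Ioc_split[of m k, OF k(1,3)] k(4) by simp
qed

end

section \<open>One linear program for each order of events\<close>

text \<open>The event times are variables alongside flows and storage levels. \<open>Total\<close>
  is an additional coordinate for the objective, as \<open>polyhedral_max\<close> maximises a
  coordinate.\<close>

datatype ('v, 'e) lp_var = Total | Time nat | Flow 'e nat | Store 'v nat

context maintenance_network
begin

text \<open>
  In a type \<open>(n, s, e)\<close>, the job on \<open>a\<close> starts at event time number \<open>s a\<close> and ends at event time
  number \<open>e a\<close>.
\<close>

definition schedule_types :: "(nat \<times> ('e \<Rightarrow> nat) \<times> ('e \<Rightarrow> nat)) set" where
  "schedule_types = {(n, s, e). n \<le> 2 * card A1 + 1 \<and> s \<in> A1 \<rightarrow>\<^sub>E {0..n} \<and> e \<in> A1 \<rightarrow>\<^sub>E {0..n} \<and>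
     s ` A1 \<union> e ` A1 \<union> {0, n} = {0..n}}"

text \<open>With \<open>s\<close> and \<open>e\<close> fixed, the outage intervals
  \<open>{s a<..e a}\<close> are constants and the capacity bounds are linear in the times.
  Consecutive times are only weakly ordered, so all constraints are weak inequalities or
  equations.\<close>

definition schedule_lp ::
    "('e \<Rightarrow> real) \<Rightarrow> ('e \<Rightarrow> real) \<Rightarrow> ('e \<Rightarrow> real) \<Rightarrow> nat \<times> ('e \<Rightarrow> nat) \<times> ('e \<Rightarrow> nat) \<Rightarrow>
     (('v, 'e) lp_var \<Rightarrow> real) \<Rightarrow> bool" where
  "schedule_lp p r d = (\<lambda>(n, s, e) z.
     z (Time 0) = 0 \<and> z (Time n) = T \<and> (\<forall>i\<in>{1..n}. z (Time (i - 1)) \<le> z (Time i)) \<and>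
     (\<forall>a\<in>A1. r a \<le> z (Time (s a)) \<and> z (Time (s a)) \<le> d a - p a \<and>
       z (Time (e a)) = z (Time (s a)) + p a) \<and>
     grid_flow n (\<lambda>i. z (Time i)) (\<lambda>a. {s a<..e a}) (\<lambda>a i. z (Flow a i)) (\<lambda>v i. z (Store v i)) \<and>
     z Total = net_outflow n (\<lambda>a i. z (Flow a i)))"

lemma finite_schedule_types: "finite schedule_types"
proof (rule finite_subset)
  show "schedule_types \<subseteq> (SIGMA n:{..2 * card A1 + 1}. (A1 \<rightarrow>\<^sub>E {0..n}) \<times> (A1 \<rightarrow>\<^sub>E {0..n}))"
    by (auto simp: schedule_types_def)
  show "finite (SIGMA n:{..2 * card A1 + 1}. (A1 \<rightarrow>\<^sub>E {0..n}) \<times> (A1 \<rightarrow>\<^sub>E {0..n}))"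
    by (intro finite_SigmaI finite_cartesian_product finite_PiE finite_jobs) auto
qed

text \<open>Times are multiplied only by capacities, so every constraint is affine with coefficients
  in \<open>K\<close>.\<close>

lemma polyhedral_schedule_lp:
  assumes "real_subfield K" "\<forall>a\<in>arcs N. cap a \<in> K" "\<forall>v\<in>W. scap v \<in> K" "T \<in> K"
    "\<forall>a\<in>A1. p a \<in> K \<and> r a \<in> K \<and> d a \<in> K"
  shows "real_subfield.polyhedral K (schedule_lp p r d \<theta>)"
proof -
  interpret real_subfield K by fact
  obtain n s e where "\<theta> = (n, s, e)" by (cases \<theta>)
  then show ?thesis
    using assms(2-5) finite_jobs finite_storage jobs_subset zero_mem
    unfolding schedule_lp_def grid_flow_def net_outflow_def
    by (auto intro: diff_mem intro!: polyhedral_conj polyhedral_ball polyhedral_eq polyhedral_le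
        affine_form.add affine_form_diff affine_form_sum affine_form.scale
        affine_form.coord affine_form.const)
qed

text \<open>The type records the positions of starts and ends in the enumeration of event times; the
  actual times, flows and storage levels then solve the program of that type.\<close>

lemma schedule_lp_of_flow:
  assumes "valid_jobs p r d" "ts \<in> feasible_starts p r d" "feasible_flow p ts x y"
  shows "\<exists>\<theta>\<in>schedule_types. \<exists>z. schedule_lp p r d \<theta> z \<and> z Total = throughput p ts x"
proof -
  define n \<tau> where "n = num_intervals p ts" and "\<tau> = event_time p ts"
  note mono = event_time_strict_mono[OF assms(1,2), folded n_def \<tau>_def]
    and image = event_time_image[OF assms(1,2), folded n_def \<tau>_def]
    and ends = event_time_0[OF assms(1,2), folded \<tau>_def]
      event_time_last[OF assms(1,2), folded n_def \<tau>_def]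
  have "\<forall>a\<in>A1. \<exists>i. i \<le> n \<and> \<tau> i = ts a"
  proof
    fix a assume "a \<in> A1"
    then have "ts a \<in> \<tau> ` {0..n}" unfolding image event_times_def by simp
    then show "\<exists>i. i \<le> n \<and> \<tau> i = ts a" by auto
  qed
  then obtain s0 where s0: "\<forall>a\<in>A1. s0 a \<le> n \<and> \<tau> (s0 a) = ts a"
    unfolding bchoice_iff by (elim exE)
  have "\<forall>a\<in>A1. \<exists>i. i \<le> n \<and> \<tau> i = ts a + p a"
  proof
    fix a assume "a \<in> A1"
    then have "ts a + p a \<in> \<tau> ` {0..n}" unfolding image event_times_def by simp
    then show "\<exists>i. i \<le> n \<and> \<tau> i = ts a + p a" by auto
  qed
  then obtain e0 where e0: "\<forall>a\<in>A1. e0 a \<le> n \<and> \<tau> (e0 a) = ts a + p a"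
    unfolding bchoice_iff by (elim exE)
  \<comment> \<open>Restriction to \<open>A1\<close> puts the position maps into the extensional
    function spaces that make the set of types finite.\<close>
  define s e where "s = restrict s0 A1" and "e = restrict e0 A1"
  have s: "s a \<le> n" "\<tau> (s a) = ts a" and e: "e a \<le> n" "\<tau> (e a) = ts a + p a" if "a \<in> A1" for a
    using s0 e0 that by (auto simp: s_def e_def)
  have inj: "inj_on \<tau> {0..n}" by (rule strict_mono_on_imp_inj_on[OF mono])
  have less_iff: "\<tau> i < \<tau> j \<longleftrightarrow> i < j" if "i \<le> n" "j \<le> n" for i j
    using strict_mono_on_less[OF mono] that by simp
  have le_iff: "\<tau> i \<le> \<tau> j \<longleftrightarrow> i \<le> j" if "i \<le> n" "j \<le> n" for i j
    using strict_mono_on_less_eq[OF mono] that by simp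
  have type: "(n, s, e) \<in> schedule_types"
  proof -
    \<comment> \<open>That every index is a start, an end, 0 or \<open>n\<close> is checked on event
      times and pulled back along the injective \<open>\<tau>\<close>.\<close>
    have "\<tau> ` (s ` A1 \<union> e ` A1 \<union> {0, n}) = \<tau> ` {0..n}"
      unfolding image event_times_def image_Un image_image using s e ends by simp
    moreover have "s ` A1 \<union> e ` A1 \<union> {0, n} \<subseteq> {0..n}" using s e by auto
    ultimately have "s ` A1 \<union> e ` A1 \<union> {0, n} = {0..n}"
      by (intro iffD1[OF inj_on_image_eq_iff[OF inj]]) simp_all
    then show ?thesis
      using s e num_intervals_le[of p ts] by (auto simp: schedule_types_def n_def s_def e_def)
  qed
  have outage: "outage p ts a = {s a<..e a}" if a: "a \<in> A1" for a
  proof -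
    have "ts a < \<tau> i \<longleftrightarrow> s a < i" "\<tau> i \<le> ts a + p a \<longleftrightarrow> i \<le> e a" if "i \<le> n" for i
      using less_iff[of "s a" i] le_iff[of i "e a"] s[OF a] e[OF a] that by simp_all
    then show ?thesis
      using e(1)[OF a] unfolding outage_def n_def[symmetric] \<tau>_def[symmetric] by auto
  qed
  define z where "z = (\<lambda>c. case c of Total \<Rightarrow> throughput p ts x | Time i \<Rightarrow> \<tau> i
    | Flow a i \<Rightarrow> x a i | Store v i \<Rightarrow> y v i)"
  have "grid_flow n \<tau> (\<lambda>a. {s a<..e a}) x y"
    using assms(3) outage
    unfolding feasible_flow_iff n_def[symmetric] \<tau>_def[symmetric] grid_flow_def by simp
  moreover have "r a \<le> ts a" "ts a \<le> d a - p a" if "a \<in> A1" for a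
    using assms(2) that PiE_mem[of ts A1 "\<lambda>a. {r a..d a - p a}" a]
    by (auto simp: feasible_starts_def)
  moreover have "\<tau> (i - 1) \<le> \<tau> i" if "i \<in> {1..n}" for i
    using le_iff that by auto
  ultimately have "schedule_lp p r d (n, s, e) z"
    using ends s e by (auto simp: schedule_lp_def z_def throughput_eq n_def)
  with type show ?thesis
    by (intro bexI[of _ "(n, s, e)"] exI[of _ z]) (auto simp: z_def)
qed

text \<open>Start times are read off the time variables. Coinciding times are then collapsed to the
  true enumeration of event times, and the flow is merged along it without changing its
  total.\<close>

lemma schedule_lp_realisation:
  assumes "valid_jobs p r d" "\<theta> \<in> schedule_types" "schedule_lp p r d \<theta> z"
  shows "\<exists>ts\<in>feasible_starts p r d. (\<forall>a\<in>A1. \<exists>i. ts a = z (Time i)) \<and>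
    (\<exists>x y. feasible_flow p ts x y \<and> throughput p ts x = z Total)"
proof -
  obtain n s e where \<theta>: "\<theta> = (n, s, e)" by (cases \<theta>)
  define \<sigma> where "\<sigma> = (\<lambda>i. z (Time i))"
  define ts where "ts = (\<lambda>a\<in>A1. \<sigma> (s a))"
  have lp: "\<sigma> 0 = 0" "\<sigma> n = T" "\<forall>i\<in>{1..n}. \<sigma> (i - 1) \<le> \<sigma> i"
    "\<And>a. a \<in> A1 \<Longrightarrow> r a \<le> \<sigma> (s a) \<and> \<sigma> (s a) \<le> d a - p a \<and> \<sigma> (e a) = \<sigma> (s a) + p a"
    "grid_flow n \<sigma> (\<lambda>a. {s a<..e a}) (\<lambda>a i. z (Flow a i)) (\<lambda>v i. z (Store v i))"
    "z Total = net_outflow n (\<lambda>a i. z (Flow a i))"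
    using assms(3) by (auto simp: \<theta> schedule_lp_def \<sigma>_def)
  have cover: "s ` A1 \<union> e ` A1 \<union> {0, n} = {0..n}"
    and se: "\<And>a. a \<in> A1 \<Longrightarrow> s a \<le> n" "\<And>a. a \<in> A1 \<Longrightarrow> e a \<le> n"
    using assms(2) by (auto simp: \<theta> schedule_types_def)
  have ts: "ts \<in> feasible_starts p r d"
    using lp(4) by (auto simp: feasible_starts_def ts_def)
  define m \<tau> where "m = num_intervals p ts" and "\<tau> = event_time p ts"
  note mono = event_time_strict_mono[OF assms(1) ts, folded m_def \<tau>_def]
    and image = event_time_image[OF assms(1) ts, folded m_def \<tau>_def]
    and ends = event_time_0[OF assms(1) ts, folded \<tau>_def]
      event_time_last[OF assms(1) ts, folded m_def \<tau>_def]
    and m_pos = num_intervals_pos[OF assms(1) ts, folded m_def]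
  have less_iff: "\<tau> i < \<tau> j \<longleftrightarrow> i < j" if "i \<le> m" "j \<le> m" for i j
    using strict_mono_on_less[OF mono] that by simp
  have \<sigma>_mono: "\<sigma> i \<le> \<sigma> j" if "i \<le> j" "j \<le> n" for i j
    using that
  proof (induction j rule: dec_induct)
    case (step j)
    then have "\<sigma> j \<le> \<sigma> (Suc j)" using lp(3)[rule_format, of "Suc j"] by simp
    with step show ?case by simp
  qed simp
  \<comment> \<open>Because the type covers all indices, the grid times of the program are exactly
    the event times of \<open>ts\<close>.\<close>
  have "event_times p ts = \<sigma> ` (s ` A1 \<union> e ` A1 \<union> {0, n})"
    unfolding event_times_def image_Un image_image using lp(1,2,4) by (simp add: ts_def)
  with cover image have images: "\<tau> ` {0..m} = \<sigma> ` {0..n}" by simp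
  have "\<exists>i. i \<le> n \<and> \<sigma> i = \<tau> j" if "j \<le> m" for j
    using images that by (metis atLeastAtMost_iff imageE imageI le0)
  then obtain k0 where k0: "\<And>j. j \<le> m \<Longrightarrow> k0 j \<le> n \<and> \<sigma> (k0 j) = \<tau> j" by metis
  \<comment> \<open>Several grid indices may carry the time 0 or \<open>T\<close>; overriding the
    ends makes the blocks cover all of \<open>{1..n}\<close>. The two updates do not clash, as
    \<open>0 < m\<close>.\<close>
  define k where "k = k0(0 := 0, m := n)"
  have k: "k 0 = 0" "k m = n" "\<And>j. j \<le> m \<Longrightarrow> k j \<le> n" "\<And>j. j \<le> m \<Longrightarrow> \<sigma> (k j) = \<tau> j"
    using k0 lp(1,2) ends m_pos by (auto simp: k_def)
  have k_mono: "k (j - 1) \<le> k j" if j: "j \<in> {1..m}" for j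
  proof (rule ccontr)
    assume "\<not> k (j - 1) \<le> k j"
    then have "\<sigma> (k j) \<le> \<sigma> (k (j - 1))" using j by (intro \<sigma>_mono k(3)) auto
    moreover have "j \<le> m" "j - 1 \<le> m" "j - 1 < j" using j by auto
    ultimately show False using k(4) less_iff[of "j - 1" j] by (metis not_le)
  qed
  \<comment> \<open>No event time lies strictly between \<open>\<tau> (j - 1)\<close> and
    \<open>\<tau> j\<close>, so an interval \<open>i\<close> of positive length in block
    \<open>j\<close> has \<open>\<sigma> i = \<tau> j\<close>. Monotonicity of
    \<open>\<sigma>\<close> then turns the time bounds of the outage into \<open>s a < i\<close> and
    \<open>i \<le> e a\<close>.\<close>
  have off: "\<sigma> (i - 1) = \<sigma> i \<or> i \<in> {s a<..e a}"
    if a: "a \<in> A1" and j: "j \<in> outage p ts a" and i: "i \<in> {k (j - 1)<..k j}" for a j i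
  proof (rule disjCI)
    assume "i \<notin> {s a<..e a}"
    have jm: "j \<in> {1..m}" and j_out: "\<sigma> (s a) < \<tau> j" "\<tau> j \<le> \<sigma> (e a)"
      using j a lp(4)[OF a] by (auto simp: outage_def m_def \<tau>_def ts_def)
    have i_n: "i \<le> n" using i k(3)[of j] jm by auto
    show "\<sigma> (i - 1) = \<sigma> i"
    proof (rule ccontr)
      assume "\<sigma> (i - 1) \<noteq> \<sigma> i"
      then have lt: "\<sigma> (i - 1) < \<sigma> i" using \<sigma>_mono[of "i - 1" i] i_n by simp
      have "\<sigma> i \<in> \<tau> ` {0..m}" unfolding images using i_n by simp
      then obtain j' where j': "j' \<le> m" "\<sigma> i = \<tau> j'" by auto
      have "\<tau> (j - 1) \<le> \<sigma> (i - 1)"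
        using \<sigma>_mono[of "k (j - 1)" "i - 1"] k(4)[of "j - 1"] i i_n jm by auto
      then have "j - 1 < j'" using lt j' less_iff[of "j - 1" j'] jm by auto
      moreover have "\<tau> j' \<le> \<tau> j"
        using \<sigma>_mono[of i "k j"] k(3,4)[of j] i j' jm by auto
      then have "j' \<le> j" using less_iff[of j j'] jm j' by auto
      ultimately have "j' = j" using jm by auto
      then have "\<sigma> i = \<tau> j" using j'(2) by simp
      then have "s a < i" using j_out(1) \<sigma>_mono[of i "s a"] se(1)[OF a] by force
      moreover have "i \<le> e a"
      proof (rule ccontr)
        assume "\<not> i \<le> e a"
        then have "\<sigma> (e a) \<le> \<sigma> (i - 1)" using i_n by (intro \<sigma>_mono) auto
        then show False using lt j_out(2) \<open>\<sigma> i = \<tau> j\<close> by simp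
      qed
      ultimately show False using \<open>i \<notin> {s a<..e a}\<close> by simp
    qed
  qed
  let ?x = "\<lambda>a j. \<Sum>i\<in>{k (j - 1)<..k j}. z (Flow a i)" and ?y = "\<lambda>v j. z (Store v (k j))"
  have "outage p ts a \<subseteq> {1..m}" for a by (auto simp: outage_def m_def)
  note merge = grid_flow_merge[OF lp(5,3) k_mono k(3) k(1,2,4) this off]
  have flow: "feasible_flow p ts ?x ?y" and total: "throughput p ts ?x = z Total"
    unfolding feasible_flow_iff throughput_eq lp(6)
    unfolding m_def[symmetric] \<tau>_def[symmetric] using merge by simp_all
  have "\<forall>a\<in>A1. \<exists>i. ts a = z (Time i)" by (auto simp: ts_def \<sigma>_def)
  moreover have "\<exists>x y. feasible_flow p ts x y \<and> throughput p ts x = z Total"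
    by (rule exI[of _ ?x], rule exI[of _ ?y]) (rule conjI[OF flow total])
  ultimately show ?thesis using ts by blast
qed

lemma schedule_lp_bounded:
  assumes "schedule_lp p r d \<theta> z"
  shows "z Total \<le> T * (\<Sum>a\<in>out_arcs N src. cap a)"
proof -
  obtain n s e where "\<theta> = (n, s, e)" by (cases \<theta>)
  then show ?thesis
    using assms net_outflow_le[of n "\<lambda>i. z (Time i)" _ "\<lambda>a i. z (Flow a i)"]
    by (auto simp: schedule_lp_def)
qed

section \<open>Optimal schedules over a subfield\<close>

lemma zero_flow_feasible:
  assumes "valid_jobs p r d" "ts \<in> feasible_starts p r d"
  shows "feasible_flow p ts (\<lambda>_ _. 0) (\<lambda>_ _. 0)"
proof -
  have "event_time p ts (i - 1) \<le> event_time p ts i" if "i \<in> {1..num_intervals p ts}" for i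
    using strict_mono_on_leD[OF event_time_strict_mono[OF assms], of "i - 1" i] that by auto
  then show ?thesis
    using cap_nonneg scap_nonneg jobs_subset
    by (auto simp: feasible_flow_iff grid_flow_def intro!: mult_nonneg_nonneg)
qed

text \<open>Take an optimum over \<open>K\<close> for each type whose program is feasible and
  realise the best of these finitely many; every competing schedule with a flow is a point of one of
  the programs. Pairs of schedule and flow are compared instead of \<open>val\<close>, since the
  existence of the maximum behind \<open>val\<close> is itself derived from this lemma.\<close>

lemma optimal_schedule_in_subfield:
  assumes K: "real_subfield K" "\<forall>a\<in>arcs N. cap a \<in> K" "\<forall>v\<in>W. scap v \<in> K" "T \<in> K"
    "\<forall>a\<in>A1. p a \<in> K \<and> r a \<in> K \<and> d a \<in> K"
    and valid: "valid_jobs p r d"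
  obtains ts x y where "ts \<in> feasible_starts p r d" "\<And>a. a \<in> A1 \<Longrightarrow> ts a \<in> K"
    "feasible_flow p ts x y"
    "\<And>ts' x' y'. ts' \<in> feasible_starts p r d \<Longrightarrow> feasible_flow p ts' x' y' \<Longrightarrow>
      throughput p ts' x' \<le> throughput p ts x"
proof -
  interpret real_subfield K by fact
  define \<Theta> where "\<Theta> = {\<theta> \<in> schedule_types. \<exists>z. schedule_lp p r d \<theta> z}"
  have "\<forall>\<theta>\<in>\<Theta>. \<exists>z. schedule_lp p r d \<theta> z \<and> (\<forall>c. z c \<in> K) \<and>
    (\<forall>z'. schedule_lp p r d \<theta> z' \<longrightarrow> z' Total \<le> z Total)"
  proof
    fix \<theta> assume "\<theta> \<in> \<Theta>"
    then obtain z0 where "schedule_lp p r d \<theta> z0" by (auto simp: \<Theta>_def)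
    then show "\<exists>z. schedule_lp p r d \<theta> z \<and> (\<forall>c. z c \<in> K) \<and>
      (\<forall>z'. schedule_lp p r d \<theta> z' \<longrightarrow> z' Total \<le> z Total)"
      by (rule polyhedral_max[OF polyhedral_schedule_lp[OF K]]) (rule schedule_lp_bounded)
  qed
  then obtain Z where Z: "\<forall>\<theta>\<in>\<Theta>. schedule_lp p r d \<theta> (Z \<theta>) \<and> (\<forall>c. Z \<theta> c \<in> K) \<and>
    (\<forall>z'. schedule_lp p r d \<theta> z' \<longrightarrow> z' Total \<le> Z \<theta> Total)"
    unfolding bchoice_iff by (elim exE)
  have fin: "finite \<Theta>" using finite_schedule_types by (simp add: \<Theta>_def)
  \<comment> \<open>Starting every job at its release time and sending no flow shows that at least
    one program is feasible.\<close>
  have "restrict r A1 \<in> feasible_starts p r d"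
    using valid by (auto simp: feasible_starts_def valid_jobs_def)
  from schedule_lp_of_flow[OF valid this zero_flow_feasible[OF valid this]]
  have "\<Theta> \<noteq> {}" by (auto simp: \<Theta>_def)
  then have "Max ((\<lambda>\<theta>. Z \<theta> Total) ` \<Theta>) \<in> (\<lambda>\<theta>. Z \<theta> Total) ` \<Theta>"
    using fin by (intro Max_in) auto
  then obtain \<theta> where \<theta>: "\<theta> \<in> \<Theta>" "Z \<theta> Total = Max ((\<lambda>\<theta>. Z \<theta> Total) ` \<Theta>)" by auto
  have "\<theta> \<in> schedule_types" "schedule_lp p r d \<theta> (Z \<theta>)"
    using \<theta>(1) Z[rule_format, OF \<theta>(1)] by (simp_all add: \<Theta>_def)
  from schedule_lp_realisation[OF valid this] obtain ts x y where
    ts: "ts \<in> feasible_starts p r d" "\<forall>a\<in>A1. \<exists>i. ts a = Z \<theta> (Time i)"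
    and flow: "feasible_flow p ts x y" "throughput p ts x = Z \<theta> Total" by blast
  show ?thesis
  proof (rule that[OF ts(1) _ flow(1)])
    show "ts a \<in> K" if "a \<in> A1" for a
      using ts(2) that Z \<theta>(1) by metis
    fix ts' x' y' assume "ts' \<in> feasible_starts p r d" "feasible_flow p ts' x' y'"
    from schedule_lp_of_flow[OF valid this] obtain \<theta>' z where
      "\<theta>' \<in> schedule_types" and z: "schedule_lp p r d \<theta>' z" "z Total = throughput p ts' x'"
      by blast
    then have \<theta>': "\<theta>' \<in> \<Theta>" unfolding \<Theta>_def by blast
    with z have "throughput p ts' x' \<le> Z \<theta>' Total" using Z by metis
    also have "\<dots> \<le> throughput p ts x"
      unfolding flow(2) \<theta>(2) using fin \<theta>' by (intro Max_ge) auto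
    finally show "throughput p ts' x' \<le> throughput p ts x" .
  qed
qed

lemma val_eqI:
  assumes "feasible_flow p ts x y"
    "\<And>x' y'. feasible_flow p ts x' y' \<Longrightarrow> throughput p ts x' \<le> throughput p ts x"
  shows "val p ts = throughput p ts x"
  unfolding val_def using assms by (intro Greatest_equality) auto

text \<open>With release times \<open>ts\<close> and deadlines \<open>ts a + p a\<close> the only
  feasible start vector is \<open>ts\<close>, so optimality over schedules and flows becomes
  optimality over flows for \<open>ts\<close>. Taking \<open>K = UNIV\<close> admits arbitrary real
  data.\<close>

lemma val_attained:
  assumes "valid_jobs p r d" "ts \<in> feasible_starts p r d"
  obtains x y where "feasible_flow p ts x y" "val p ts = throughput p ts x"
proof -
  let ?d = "\<lambda>a. ts a + p a"
  have bounds: "ts a \<in> {r a..d a - p a}" if "a \<in> A1" for a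
    using assms(2) that unfolding feasible_starts_def by (rule PiE_mem)
  have valid: "valid_jobs p ts ?d"
    using assms(1) bounds by (fastforce simp: valid_jobs_def)
  have "real_subfield UNIV" by unfold_locales auto
  then show ?thesis
  proof (rule optimal_schedule_in_subfield[OF _ _ _ _ _ valid])
    fix ts' x y
    assume ts': "ts' \<in> feasible_starts p ts ?d" "feasible_flow p ts' x y"
      and opt: "\<And>ts'' x' y'. ts'' \<in> feasible_starts p ts ?d \<Longrightarrow> feasible_flow p ts'' x' y' \<Longrightarrow>
        throughput p ts'' x' \<le> throughput p ts' x"
    have "ts' = ts"
    proof (rule extensionalityI)
      show "ts' \<in> extensional A1" "ts \<in> extensional A1"
        using ts'(1) assms(2) by (auto simp: feasible_starts_def PiE_def)
      show "ts' a = ts a" if "a \<in> A1" for a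
        using PiE_mem[OF ts'(1)[unfolded feasible_starts_def] that] by simp
    qed
    then have flow: "feasible_flow p ts x y" using ts'(2) by simp
    have "val p ts = throughput p ts x"
      using opt[OF ts'(1)] \<open>ts' = ts\<close> by (intro val_eqI[OF flow]) simp
    with flow show ?thesis by (rule that)
  qed simp_all
qed

text \<open>As \<open>val\<close> of each competitor is the throughput of some flow, the comparison
  of throughputs carries over to \<open>val\<close>.\<close>

lemma rational_optimal_solution:
  assumes "\<forall>a\<in>arcs N. cap a \<in> \<rat>" "\<forall>v\<in>W. scap v \<in> \<rat>" "T \<in> \<rat>"
    "\<forall>a\<in>A1. p a \<in> \<rat> \<and> r a \<in> \<rat> \<and> d a \<in> \<rat>" "valid_jobs p r d"
  shows "\<exists>ts. optimal_solution p r d ts \<and> (\<forall>a\<in>A1. ts a \<in> \<rat>)"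
proof -
  have "real_subfield \<rat>" by unfold_locales auto
  from optimal_schedule_in_subfield[OF this assms] obtain ts x y where
    ts: "ts \<in> feasible_starts p r d" "\<And>a. a \<in> A1 \<Longrightarrow> ts a \<in> \<rat>" "feasible_flow p ts x y"
    and opt: "\<And>ts' x' y'. ts' \<in> feasible_starts p r d \<Longrightarrow> feasible_flow p ts' x' y' \<Longrightarrow>
      throughput p ts' x' \<le> throughput p ts x" by blast
  have "val p ts' \<le> val p ts" if "ts' \<in> feasible_starts p r d" for ts'
  proof -
    obtain x' y' where "feasible_flow p ts' x' y'" "val p ts' = throughput p ts' x'"
      using val_attained[OF assms(5) \<open>ts' \<in> _\<close>] by blast
    moreover have "val p ts = throughput p ts x"
      by (rule val_eqI[OF ts(3)]) (rule opt[OF ts(1)])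
    ultimately show ?thesis using opt[OF that] by simp
  qed
  then have "optimal_solution p r d ts"
    using ts(1) by (auto simp: optimal_solution_def is_arg_max_def not_less)
  with ts(2) show ?thesis by blast
qed

text \<open>Job parameters are total functions and so form an infinite set even for integer values;
  passing to their restrictions to \<open>A1\<close> makes the relevant ones finite in
  number.\<close>

lemma optimal_solution_cong:
  assumes "\<And>a. a \<in> A1 \<Longrightarrow> p a = p' a \<and> r a = r' a \<and> d a = d' a"
  shows "optimal_solution p r d = optimal_solution p' r' d'"
proof -
  have events: "event_times p ts = event_times p' ts" for ts
    using assms by (simp add: event_times_def cong: image_cong_simp)
  have "feasible_flow p ts x y = feasible_flow p' ts x y" "throughput p ts x = throughput p' ts x"
    for ts x y
    using assms
    by (simp_all add: feasible_flow_def throughput_def outage_def num_intervals_def event_time_def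
        events)
  then have "val p = val p'" by (intro ext) (simp add: val_def)
  moreover have "feasible_starts p r d = feasible_starts p' r' d'"
    unfolding feasible_starts_def using assms by (intro PiE_cong) simp
  ultimately show ?thesis by (intro ext) (simp add: optimal_solution_def)
qed

end

section \<open>A common denominator for all integer job parameters\<close>

text \<open>The product of positive denominators of the elements works.\<close>

lemma common_denominator:
  assumes "finite S" "S \<subseteq> \<rat>"
  obtains D :: nat where "0 < D" "\<And>q. q \<in> S \<Longrightarrow> real D * q \<in> \<int>"
proof -
  have "\<exists>D::nat. 0 < D \<and> (\<forall>q\<in>S. real D * q \<in> \<int>)"
    using assms
  proof (induction S)
    case empty
    then show ?case by auto
  next
    case (insert q S)
    then obtain D :: nat where D: "0 < D" "\<forall>q\<in>S. real D * q \<in> \<int>" by auto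
    from insert.prems obtain a b :: int where ab: "0 < b" "q = of_int a / of_int b"
      by (auto elim: Rats_cases')
    have "real (D * nat b) * q = of_int (int D * a)"
      using ab by simp
    then have "real (D * nat b) * q \<in> \<int>" by (metis Ints_of_int)
    moreover have "real (D * nat b) * q' \<in> \<int>" if "q' \<in> S" for q'
    proof -
      have "real (D * nat b) * q' = real (nat b) * (real D * q')" by simp
      then show ?thesis using D that by (metis Ints_mult Ints_of_nat)
    qed
    ultimately show ?case
      using D ab by (intro exI[of _ "D * nat b"]) auto
  qed
  then show ?thesis using that by blast
qed

theorem proposition2:
  fixes N :: "('v, 'e) pre_digraph"
    and src snk :: 'v
    and W :: "'v set"
    and cap :: "'e \<Rightarrow> real"
    and scap :: "'v \<Rightarrow> real"
    and A1 :: "'e set"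
    and T :: real
  assumes "maintenance_network N src snk W cap scap A1 T"
    and "W \<noteq> {}"
    and "\<forall>a\<in>arcs N. cap a \<in> \<int>"
    and "\<forall>v\<in>W. scap v \<in> \<int>"
    and "T \<in> \<int>"
  shows "(\<forall>p r d. (\<forall>a\<in>A1. p a \<in> \<int> \<and> r a \<in> \<int> \<and> d a \<in> \<int>) \<and>
              maintenance_network.valid_jobs A1 T p r d \<longrightarrow>
            (\<exists>ts. maintenance_network.optimal_solution N src snk W cap scap A1 T p r d ts \<and>
                  (\<forall>a\<in>A1. ts a \<in> \<rat>))) \<and>
         (\<exists>D::nat. 0 < D \<and>
            (\<forall>p r d. (\<forall>a\<in>A1. p a \<in> \<int> \<and> r a \<in> \<int> \<and> d a \<in> \<int>) \<and>
                maintenance_network.valid_jobs A1 T p r d \<longrightarrow>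
              (\<exists>ts. maintenance_network.optimal_solution N src snk W cap scap A1 T p r d ts \<and>
                    (\<forall>a\<in>A1. real D * ts a \<in> \<int>))))"
proof -
  interpret maintenance_network N src snk W cap scap A1 T by fact
  have rational: "\<exists>ts. optimal_solution p r d ts \<and> (\<forall>a\<in>A1. ts a \<in> \<rat>)"
    if "\<forall>a\<in>A1. p a \<in> \<int> \<and> r a \<in> \<int> \<and> d a \<in> \<int>" "valid_jobs p r d" for p r d
    using that assms(3-5) Ints_subset_Rats by (intro rational_optimal_solution) blast+
  \<comment> \<open>Validity forces \<open>p a\<close>, \<open>r a\<close> and \<open>d a\<close>
    into \<open>{0..T}\<close>, so restricted integer parameters belong to this finite set, which
    depends only on \<open>A1\<close> and \<open>T\<close>.\<close>
  define G :: "('e \<Rightarrow> real) set" where "G = A1 \<rightarrow>\<^sub>E of_int ` {0..\<lfloor>T\<rfloor>}"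
  define best where "best p r d = (SOME ts. optimal_solution p r d ts \<and> (\<forall>a\<in>A1. ts a \<in> \<rat>))"
    for p r d
  \<comment> \<open>\<open>G \<times> G \<times> G\<close> also contains invalid triples, for which
    \<open>best\<close> may be arbitrary; the intersection discards any irrational values they
    contribute.\<close>
  define S where "S = (\<Union>(p, r, d)\<in>G \<times> G \<times> G. best p r d ` A1) \<inter> \<rat>"
  have "finite G" by (auto simp: G_def intro: finite_PiE finite_jobs)
  then have "finite S" by (auto simp: S_def finite_jobs)
  then obtain D :: nat where D: "0 < D" "\<And>q. q \<in> S \<Longrightarrow> real D * q \<in> \<int>"
    using common_denominator[of S] by (auto simp: S_def)
  have "\<exists>ts. optimal_solution p r d ts \<and> (\<forall>a\<in>A1. real D * ts a \<in> \<int>)"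
    if int: "\<forall>a\<in>A1. p a \<in> \<int> \<and> r a \<in> \<int> \<and> d a \<in> \<int>" and valid: "valid_jobs p r d" for p r d
  proof -
    have G_I: "restrict f A1 \<in> G" if "\<forall>a\<in>A1. f a \<in> \<int> \<and> 0 \<le> f a \<and> f a \<le> T" for f
      unfolding G_def restrict_PiE_iff
    proof
      fix a assume "a \<in> A1"
      with that have "f a \<in> \<int>" "0 \<le> f a" "f a \<le> T" by blast+
      moreover from this(1) obtain c where "f a = of_int c" by (rule Ints_cases)
      ultimately show "f a \<in> of_int ` {0..\<lfloor>T\<rfloor>}" by (auto simp: le_floor_iff)
    qed
    have "0 < p a \<and> 0 \<le> r a \<and> r a \<le> d a - p a \<and> d a \<le> T" if "a \<in> A1" for a
      using valid that by (auto simp: valid_jobs_def)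
    then have "restrict p A1 \<in> G" "restrict r A1 \<in> G" "restrict d A1 \<in> G"
      using int by (force intro!: G_I)+
    then have sub: "best (restrict p A1) (restrict r A1) (restrict d A1) ` A1 \<inter> \<rat> \<subseteq> S"
      by (auto simp: S_def)
    have cong: "optimal_solution (restrict p A1) (restrict r A1) (restrict d A1) = optimal_solution p r d"
      by (intro optimal_solution_cong) simp
    have "optimal_solution p r d (best (restrict p A1) (restrict r A1) (restrict d A1)) \<and>
      (\<forall>a\<in>A1. best (restrict p A1) (restrict r A1) (restrict d A1) a \<in> \<rat>)"
      unfolding best_def cong by (rule someI_ex[OF rational[OF that]])
    with sub D(2) show ?thesis by blast
  qed
  with rational D(1) show ?thesis by blast
qed

end
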